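(* There exists an integer $n_0$ such that for every $n \ge n_0$ the following holds. If $(\mathcal{F},\mathcal{G})$ is a cross-Sperner pair of families with $\emptyset \neq \mathcal{F}, \mathcal{G} \subseteq 2^{[n]}$ (i.e. both families are non-empty), then $$|\mathcal{F}|+|\mathcal{G}| \le F(n,1)+1 = 2^n-2^{\lceil n/2\rceil}-2^{\lfloor n/2\rfloor}+2,$$ and equality $|\mathcal{F}|+|\mathcal{G}| = F(n,1)+1$ holds if and only if one of the families $\mathcal{F}$, $\mathcal{G}$ consists of exactly one set $S$ of size $\lfloor n/2 \rfloor$ or $\lceil n/2 \rceil$ and the other family consists of all subsets of $[n]$ not contained in $S$ and not containing $S$.
   Context: $[n]=\{1,\dots,n\}$ and $2^{[n]}$ is its power set. A pair $(\mathcal{F},\mathcal{G})$ of families of sets is cross-Sperner if there exists no pair of sets $F \in \mathcal{F}$, $G \in \mathcal{G}$ with $F \subseteq G$ or $G \subseteq F$ (in particular $\mathcal{F}\cap\mathcal{G}=\emptyset$). Define $$F(n,m)=\max\{|\mathcal{G}| : \mathcal{G} \subseteq 2^{[n]},\ \exists\, \mathcal{F} \subseteq 2^{[n]} \text{ with } |\mathcal{F}|=m \text{ and } (\mathcal{F},\mathcal{G}) \text{ cross-Sperner}\}.$$ *)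

theory Defs
  imports Main
begin

definition cross_Sperner :: "'a set set \<Rightarrow> 'a set set \<Rightarrow> bool" where
  "cross_Sperner \<F> \<G> \<longleftrightarrow> \<not> (\<exists>A\<in>\<F>. \<exists>B\<in>\<G>. A \<subseteq> B \<or> B \<subseteq> A)"

text \<open>The quantity \<open>F(n,m)\<close>. The set of candidate cardinalities is finite, and it is non-empty exactly
  if \<open>m \<le> 2 ^ n\<close> (take \<open>\<G> = {}\<close>), so \<^const>\<open>Max\<close> is the genuine maximum for all such \<open>m\<close>.\<close>

definition max_cross_Sperner :: "nat \<Rightarrow> nat \<Rightarrow> nat" where
  "max_cross_Sperner n m =
     Max {card \<G> | \<G> :: nat set set. \<G> \<subseteq> Pow {1..n} \<and>
            (\<exists>\<F>. \<F> \<subseteq> Pow {1..n} \<and> card \<F> = m \<and> cross_Sperner \<F> \<G>)}"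

end

theory Submission
  imports Defs Complex_Main
begin

text \<open>
  Let \<open>N = 2\<^sup>n\<close>, and let \<open>U\<close>, \<open>D\<close> be the upward and downward closures of \<open>\<F>\<close> in the cube. The family
  \<open>\<G>\<close> avoids \<open>U \<union> D\<close>, whence \<open>|\<F>| + |\<G>| \<le> N - (|U| + |D|) + 2 |U \<inter> D|\<close>, and Kleitman's correlation
  inequality gives \<open>N |U \<inter> D| \<le> |U| |D|\<close>. The closures of \<open>\<G>\<close> are disjoint from the opposite closures
  of \<open>\<F>\<close>, so after possibly exchanging the two families \<open>|U| + |D| \<le> N\<close>. If \<open>|\<F>| \<ge> 2\<close>, then
  \<open>y = |U| + |D|\<close> satisfies \<open>8 N \<le> y\<^sup>2\<close>, and \<open>y - 2 |U \<inter> D| \<ge> y - y\<^sup>2 / (2 N)\<close> is at least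
  \<open>\<surd>(8 N) - 4\<close>, which for large \<open>n\<close> exceeds the deficiency of the extremal pairs (of order at most
  \<open>\<surd>(9 N / 2)\<close>). If \<open>\<F> = {S}\<close>, the sum is at most \<open>N - 2\<^sup>s - 2\<^sup>n\<^sup>-\<^sup>s + 2\<close> with \<open>s = |S|\<close>.
\<close>

section \<open>Closures, incomparability and cross-Sperner pairs with a singleton\<close>

definition up_closure :: "'a set \<Rightarrow> 'a set set \<Rightarrow> 'a set set" where
  "up_closure A \<F> = {X. X \<subseteq> A \<and> (\<exists>S\<in>\<F>. S \<subseteq> X)}"

text \<open>The ambient set can stay implicit here, unlike in \<open>up_closure\<close>: subsets of
  members of a family inside \<open>Pow A\<close> lie in \<open>Pow A\<close> again.\<close>

definition down_closure :: "'a set set \<Rightarrow> 'a set set" where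
  "down_closure \<F> = {X. \<exists>S\<in>\<F>. X \<subseteq> S}"

definition incomparable :: "'a set \<Rightarrow> 'a set \<Rightarrow> 'a set set" where
  "incomparable A S = {X. X \<subseteq> A \<and> \<not> X \<subseteq> S \<and> \<not> S \<subseteq> X}"

lemma cross_Sperner_sym: "cross_Sperner \<F> \<G> \<longleftrightarrow> cross_Sperner \<G> \<F>"
  by (auto simp: cross_Sperner_def)

lemma cross_Sperner_singleton:
  assumes "\<G> \<subseteq> Pow A"
  shows "cross_Sperner {S} \<G> \<longleftrightarrow> \<G> \<subseteq> incomparable A S"
  using assms by (auto simp: cross_Sperner_def incomparable_def)

section \<open>Kleitman's correlation inequality\<close>

lemma card_Pow_insert_split:
  assumes "finite A" "x \<notin> A" "\<F> \<subseteq> Pow (insert x A)"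
  shows "card \<F> = card {X \<in> Pow A. X \<in> \<F>} + card {X \<in> Pow A. insert x X \<in> \<F>}"
proof -
  have eq: "\<F> = {X \<in> Pow A. X \<in> \<F>} \<union> insert x ` {X \<in> Pow A. insert x X \<in> \<F>}" (is "_ = ?P \<union> _ ` ?Q")
  proof (rule set_eqI)
    fix X
    show "X \<in> \<F> \<longleftrightarrow> X \<in> ?P \<union> insert x ` ?Q"
    proof (cases "x \<in> X")
      case True
      then have "X = insert x (X - {x})" by auto
      then show ?thesis using assms True by (auto intro!: image_eqI[of _ _ "X - {x}"])
    next
      case False
      then show ?thesis using assms by auto
    qed
  qed
  have inj: "inj_on (insert x) ?Q"
    using assms(2) by (auto simp: inj_on_def)
  have "card \<F> = card ?P + card (insert x ` ?Q)"
    using assms(1,2) by (subst eq, intro card_Un_disjoint) auto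
  then show ?thesis using card_image[OF inj] by simp
qed

text \<open>The right side minus the left side is \<open>(b - a) * (d - c)\<close>, which becomes
  \<open>i * j\<close> after the substitution. This is Chebyshev's sum inequality for two
  terms.\<close>

lemma rearrangement_2:
  fixes a b c d :: nat
  assumes "a \<le> b" "c \<le> d"
  shows "2 * (a * d + b * c) \<le> (a + b) * (c + d)"
proof -
  obtain i j where "b = a + i" "d = c + j"
    using assms le_Suc_ex by metis
  then show ?thesis by (simp add: algebra_simps)
qed

text \<open>Induction on the ground set: removing \<open>x\<close> splits \<open>U\<close> and
  \<open>D\<close> into two traces each. The traces of \<open>U\<close> grow and those of
  \<open>D\<close> shrink when \<open>x\<close> is added, and this opposite monotonicity lets the
  two inductive bounds be combined.\<close>

lemma Kleitman_correlation:
  assumes "finite A" "U \<subseteq> Pow A" "D \<subseteq> Pow A"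
    and "\<And>X Y. X \<in> U \<Longrightarrow> X \<subseteq> Y \<Longrightarrow> Y \<subseteq> A \<Longrightarrow> Y \<in> U"
    and "\<And>X Y. X \<in> D \<Longrightarrow> Y \<subseteq> X \<Longrightarrow> Y \<in> D"
  shows "2 ^ card A * card (U \<inter> D) \<le> card U * card D"
  using assms
proof (induction A arbitrary: U D rule: finite_induct)
  case empty
  then have "U = {} \<or> U = {{}}" "finite D"
    by (auto intro: finite_subset)
  then show ?case
    by (auto intro!: card_mono)
next
  case (insert x A)
  define U0 U1 D0 D1 where
    "U0 = {X \<in> Pow A. X \<in> U}" and "U1 = {X \<in> Pow A. insert x X \<in> U}" and
    "D0 = {X \<in> Pow A. X \<in> D}" and "D1 = {X \<in> Pow A. insert x X \<in> D}"
  note defs = U0_def U1_def D0_def D1_def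
  have fin: "finite U1" "finite D0"
    using insert.hyps(1) by (auto simp: defs)
  have up: "Y \<in> U" if "X \<in> U" "X \<subseteq> Y" "Y \<subseteq> insert x A" for X Y
    using insert.prems(3) that by blast
  have down: "Y \<in> D" if "X \<in> D" "Y \<subseteq> X" for X Y
    using insert.prems(4) that by blast
  have "U0 \<subseteq> U1" "D1 \<subseteq> D0"
    using up[OF _ subset_insertI[of _ x]] down[OF _ subset_insertI[of _ x]]
    unfolding defs by blast+
  then have le: "card U0 \<le> card U1" "card D1 \<le> card D0"
    using fin by (auto intro: card_mono)
  have "2 ^ card A * card (U0 \<inter> D0) \<le> card U0 * card D0"
    by (rule insert.IH) (auto simp: defs intro: up down)
  moreover have "2 ^ card A * card (U1 \<inter> D1) \<le> card U1 * card D1"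
  proof (rule insert.IH)
    fix X Y
    show "Y \<in> U1" if "X \<in> U1" "X \<subseteq> Y" "Y \<subseteq> A"
      using that up[of "insert x X" "insert x Y"] by (auto simp: defs)
    show "Y \<in> D1" if "X \<in> D1" "Y \<subseteq> X"
      using that down[of "insert x X" "insert x Y"] by (auto simp: defs)
  qed (auto simp: defs)
  moreover have "card (U \<inter> D) = card (U0 \<inter> D0) + card (U1 \<inter> D1)"
  proof -
    have "U0 \<inter> D0 = {X \<in> Pow A. X \<in> U \<inter> D}" "U1 \<inter> D1 = {X \<in> Pow A. insert x X \<in> U \<inter> D}"
      by (auto simp: defs)
    then show ?thesis
      using card_Pow_insert_split[OF insert.hyps, of "U \<inter> D"] insert.prems(1) by auto
  qed
  ultimately have "2 ^ card (insert x A) * card (U \<inter> D) \<le> 2 * (card U0 * card D0 + card U1 * card D1)"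
    using insert.hyps by (simp add: algebra_simps)
  \<comment> \<open>The factor 2 from the new element is exactly the one that the rearrangement
    absorbs.\<close>
  also have "\<dots> \<le> (card U0 + card U1) * (card D1 + card D0)"
    by (rule rearrangement_2) (use le in auto)
  also have "\<dots> = card U * card D"
    using card_Pow_insert_split[OF insert.hyps insert.prems(1)]
      card_Pow_insert_split[OF insert.hyps insert.prems(2)] by (simp add: defs add.commute)
  finally show ?case .
qed

section \<open>Counting incomparable sets and estimating powers of two\<close>

lemma card_supersets:
  assumes "finite A" "S \<subseteq> A"
  shows "card {X. X \<subseteq> A \<and> S \<subseteq> X} = 2 ^ (card A - card S)"
proof -
  have "bij_betw (\<lambda>X. X \<union> S) (Pow (A - S)) {X. X \<subseteq> A \<and> S \<subseteq> X}"
    by (rule bij_betw_byWitness[where f' = "\<lambda>X. X - S"]) (use assms in auto)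
  then have "card {X. X \<subseteq> A \<and> S \<subseteq> X} = card (Pow (A - S))"
    by (simp add: bij_betw_same_card)
  then show ?thesis
    using assms by (simp add: card_Pow card_Diff_subset finite_subset)
qed

text \<open>Inclusion-exclusion: subsets and supersets of \<open>S\<close> share only
  \<open>S\<close>, hence the \<open>+ 1\<close>. The equation is over the integers because
  truncated subtraction would falsify it for \<open>S = A\<close> and \<open>S = {}\<close>.\<close>

lemma card_incomparable:
  assumes "finite A" "S \<subseteq> A"
  shows "int (card (incomparable A S)) = 2 ^ card A - 2 ^ card S - 2 ^ (card A - card S) + 1"
proof -
  let ?U = "{X. X \<subseteq> A \<and> S \<subseteq> X}"
  have fin: "finite ?U" "finite S"
    using assms by (auto intro: finite_subset)
  have int: "Pow S \<inter> ?U = {S}" using assms by auto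
  have "card (Pow S) + card ?U = card (Pow S \<union> ?U) + 1"
    using card_Un_Int[of "Pow S" ?U] fin unfolding int by simp
  moreover have "card (incomparable A S) + card (Pow S \<union> ?U) = card (Pow A)"
  proof -
    have "incomparable A S \<union> (Pow S \<union> ?U) = Pow A" "incomparable A S \<inter> (Pow S \<union> ?U) = {}"
      using assms by (auto simp: incomparable_def)
    then show ?thesis
      using assms by (metis card_Un_disjoint finite_Pow_iff finite_Un)
  qed
  ultimately have "card (incomparable A S) + (2 ^ card S + 2 ^ (card A - card S)) = 2 ^ card A + 1"
    using fin assms by (simp add: card_Pow card_supersets)
  then have "int (card (incomparable A S) + (2 ^ card S + 2 ^ (card A - card S))) = int (2 ^ card A + 1)"
    by (rule arg_cong)
  then show ?thesis by simp
qed

text \<open>Multiplied by \<open>2 ^ s\<close>, the difference of the two sums factors as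
  \<open>(2 ^ s - 2 ^ p) * (2 ^ s - 2 ^ q)\<close>, where \<open>p\<close> and \<open>q\<close> are
  the halves of \<open>n\<close>. No integer lies strictly between \<open>p\<close> and
  \<open>q\<close>, so the factors never have opposite signs.\<close>

lemma power_sum_middle:
  fixes n s :: nat
  assumes "s \<le> n"
  shows "(2::int) ^ ((n + 1) div 2) + 2 ^ (n div 2) \<le> 2 ^ s + 2 ^ (n - s)" (is "?M \<le> ?f")
    and "(2::int) ^ s + 2 ^ (n - s) = 2 ^ ((n + 1) div 2) + 2 ^ (n div 2) \<longleftrightarrow>
      s = n div 2 \<or> s = (n + 1) div 2"
proof -
  let ?p = "n div 2" and ?q = "(n + 1) div 2"
  have "(2::int) ^ s * 2 ^ (n - s) = 2 ^ ?p * 2 ^ ?q"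
    using assms unfolding power_add[symmetric] by (intro arg_cong[of _ _ "power 2"]) arith
  then have eq: "2 ^ s * (?f - ?M) = ((2::int) ^ s - 2 ^ ?p) * (2 ^ s - 2 ^ ?q)"
    by (simp add: algebra_simps)
  have "s \<le> ?p \<and> s \<le> ?q \<or> ?p \<le> s \<and> ?q \<le> s" by arith
  then have "0 \<le> ((2::int) ^ s - 2 ^ ?p) * (2 ^ s - 2 ^ ?q)"
    by (auto simp: zero_le_mult_iff)
  then have "0 \<le> (2::int) ^ s * (?f - ?M)" unfolding eq .
  then show "?M \<le> ?f"
    by (simp add: zero_le_mult_iff)
  have "?f = ?M \<longleftrightarrow> (2::int) ^ s * (?f - ?M) = 0" by simp
  also have "\<dots> \<longleftrightarrow> s = ?p \<or> s = ?q" unfolding eq by simp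
  finally show "?f = ?M \<longleftrightarrow> s = ?p \<or> s = ?q" .
qed

text \<open>The constant 9 comes from odd \<open>n = 2 * k + 1\<close>, where the sum is
  \<open>3 * 2 ^ k\<close> and equality holds; even \<open>n\<close> would allow 8.\<close>

lemma power_sum_middle_square_le:
  fixes n :: nat
  shows "2 * ((2::real) ^ ((n + 1) div 2) + 2 ^ (n div 2)) ^ 2 \<le> 9 * 2 ^ n"
proof (cases "even n")
  case True
  then obtain k where n: "n = 2 * k" by auto
  then have "(n + 1) div 2 = k" "n div 2 = k" by auto
  moreover have "(2::real) ^ n = (2 ^ k)\<^sup>2"
    unfolding n by (rule power_even_eq)
  ultimately show ?thesis by (simp add: power_mult_distrib)
next
  case False
  then obtain k where n: "n = 2 * k + 1" by (rule oddE)
  then have "(n + 1) div 2 = Suc k" "n div 2 = k" by auto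
  moreover have "(2::real) ^ n = 2 * (2 ^ k)\<^sup>2"
    unfolding n by (simp add: power_even_eq)
  ultimately show ?thesis by (simp add: power_mult_distrib)
qed

text \<open>To be read with \<open>N\<close> the size of the cube, \<open>M\<close> the middle power
  sum, \<open>u\<close> and \<open>d\<close> the sizes of the closures and \<open>k\<close> the size
  of their intersection. The bounds \<open>y - 2 * k \<ge> z - 4\<close> and
  \<open>M \<le> 3 * z / 4\<close> give the claim as soon as \<open>z > 8\<close>.\<close>

lemma closure_deficiency_ineq:
  fixes N M k u d :: real
  assumes "16 \<le> N" "2 * M\<^sup>2 \<le> 9 * N" "2 \<le> k" "N * k \<le> u * d" "0 \<le> u" "0 \<le> d" "u + d \<le> N"
  shows "M + 2 * k < u + d + 2"
proof -
  define y where "y = u + d"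
  define z where "z = sqrt (8 * N)"
  have z2: "z\<^sup>2 = 8 * N" using assms(1) by (simp add: z_def)
  \<comment> \<open>AM-GM; together with \<open>k \<ge> 2\<close> it forces
    \<open>y \<ge> z\<close>.\<close>
  have "4 * (u * d) \<le> y\<^sup>2"
    using zero_le_power2[of "u - d"] by (simp add: y_def power2_eq_square algebra_simps)
  then have k: "4 * (N * k) \<le> y\<^sup>2" using assms(4) by simp
  have "N * 2 \<le> N * k" using assms(1,3) by (intro mult_left_mono) auto
  then have "z\<^sup>2 \<le> y\<^sup>2" using k z2 by simp
  then have zy: "z \<le> y" using assms(5,6) by (auto simp: y_def intro: power2_le_imp_le)
  have "8\<^sup>2 < z\<^sup>2" using assms(1) z2 by simp
  then have z8: "8 < z" by (rule power2_less_imp_less) (use assms(1) in \<open>simp add: z_def\<close>)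
  \<comment> \<open>Monotonicity of \<open>2 * N * t - t * t\<close> for \<open>t\<close> up to
    \<open>N\<close>, written as a factored difference of its values at \<open>y\<close> and
    \<open>z\<close>.\<close>
  have "0 \<le> (y - z) * (2 * N - y - z)"
    using zy assms(7) by (intro mult_nonneg_nonneg) (auto simp: y_def)
  then have "2 * N * (z - 4) \<le> 2 * N * y - y\<^sup>2"
    using z2 by (simp add: power2_eq_square algebra_simps)
  also have "\<dots> \<le> 2 * N * (y - 2 * k)" using k by (simp add: algebra_simps)
  finally have "z - 4 \<le> y - 2 * k" using assms(1) by simp
  moreover have "4 * M \<le> 3 * z"
  proof (rule power2_le_imp_le)
    show "(4 * M)\<^sup>2 \<le> (3 * z)\<^sup>2" using assms(2) z2 by (simp add: power_mult_distrib)
  qed (use z8 in simp)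
  ultimately show ?thesis using z8 by (simp add: y_def)
qed

section \<open>Bounds when the closures of one family are small\<close>

lemma cross_Sperner_two_sets_bound:
  assumes "finite A" "4 \<le> card A" "\<F> \<subseteq> Pow A" "\<G> \<subseteq> Pow A" "cross_Sperner \<F> \<G>" "2 \<le> card \<F>"
    and "card (up_closure A \<F>) + card (down_closure \<F>) \<le> 2 ^ card A"
  shows "int (card \<F> + card \<G>) < 2 ^ card A - 2 ^ ((card A + 1) div 2) - 2 ^ (card A div 2) + 2"
proof -
  let ?U = "up_closure A \<F>" and ?D = "down_closure \<F>" and ?n = "card A"
  let ?M = "2 ^ ((?n + 1) div 2) + 2 ^ (?n div 2)"
  have sub: "?U \<subseteq> Pow A" "?D \<subseteq> Pow A"
    using assms(3) by (auto simp: up_closure_def down_closure_def)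
  have fin: "finite ?U" "finite ?D" "finite \<G>"
    using sub assms(1,4) by (auto intro: finite_subset)
  have Kl: "2 ^ ?n * card (?U \<inter> ?D) \<le> card ?U * card ?D"
    using assms(1) sub
    by (rule Kleitman_correlation) (unfold up_closure_def down_closure_def, blast+)
  have "\<F> \<subseteq> ?U \<inter> ?D"
    using assms(3) by (auto simp: up_closure_def down_closure_def)
  then have F: "card \<F> \<le> card (?U \<inter> ?D)"
    using fin by (intro card_mono) auto
  have "\<G> \<inter> (?U \<union> ?D) = {}"
    using assms(5) by (auto simp: up_closure_def down_closure_def cross_Sperner_def)
  then have "card \<G> + card (?U \<union> ?D) = card (\<G> \<union> (?U \<union> ?D))"
    using fin by (simp add: card_Un_disjoint)
  also have "\<dots> \<le> card (Pow A)"
    using sub assms(1,4) by (intro card_mono) auto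
  finally have G: "card \<G> + card (?U \<union> ?D) \<le> 2 ^ ?n"
    using assms(1) by (simp add: card_Pow)
  have UD: "card ?U + card ?D = card (?U \<union> ?D) + card (?U \<inter> ?D)"
    using fin by (intro card_Un_Int)
  have "(2::real) ^ 4 \<le> 2 ^ ?n"
    using assms(2) by (intro power_increasing) auto
  then have "real ?M + 2 * real (card (?U \<inter> ?D)) < real (card ?U) + real (card ?D) + 2"
  proof (intro closure_deficiency_ineq[where N = "2 ^ ?n"])
    show "2 * (real ?M)\<^sup>2 \<le> 9 * 2 ^ ?n"
      using power_sum_middle_square_le[of ?n] by simp
    show "2 ^ ?n * real (card (?U \<inter> ?D)) \<le> real (card ?U) * real (card ?D)"
      using of_nat_mono[OF Kl, where 'a = real] by simp
    show "real (card ?U) + real (card ?D) \<le> 2 ^ ?n"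
      using of_nat_mono[OF assms(7), where 'a = real] by simp
  qed (use F assms(6) in auto)
  then have "?M + 2 * card (?U \<inter> ?D) < card ?U + card ?D + 2"
    by linarith
  \<comment> \<open>\<open>F\<close>, \<open>G\<close> and \<open>UD\<close> bound the two
    cardinalities by \<open>2 ^ ?n - card ?U - card ?D + 2 * card (?U \<inter> ?D)\<close>.\<close>
  then have "card \<F> + card \<G> + ?M < 2 ^ ?n + 2"
    using F G UD by linarith
  then have "int (card \<F> + card \<G> + ?M) < int (2 ^ ?n + 2)"
    by (rule iffD2[OF of_nat_less_iff])
  then show ?thesis by simp
qed

text \<open>Two independent losses occur: \<open>\<G>\<close> may miss sets incomparable to
  \<open>S\<close>, and the size of \<open>S\<close> may be off the middle. Equality means that both
  vanish.\<close>

lemma cross_Sperner_singleton_bound: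
  assumes "finite A" "S \<subseteq> A" "\<G> \<subseteq> Pow A" "cross_Sperner {S} \<G>"
  defines "K \<equiv> 2 ^ card A - 2 ^ ((card A + 1) div 2) - 2 ^ (card A div 2) + 2"
  shows "int (1 + card \<G>) \<le> K"
    and "int (1 + card \<G>) = K \<longleftrightarrow>
      (card S = card A div 2 \<or> card S = (card A + 1) div 2) \<and> \<G> = incomparable A S"
proof -
  have sub: "\<G> \<subseteq> incomparable A S"
    using assms(3,4) cross_Sperner_singleton by blast
  have fin: "finite (incomparable A S)"
    using assms(1) by (simp add: incomparable_def)
  have le: "card \<G> \<le> card (incomparable A S)"
    using fin sub by (rule card_mono)
  have eq: "card \<G> = card (incomparable A S) \<longleftrightarrow> \<G> = incomparable A S"
    using card_subset_eq[OF fin sub] by auto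
  have "card S \<le> card A"
    using assms(1,2) by (rule card_mono)
  note mid = power_sum_middle[OF this]
  show "int (1 + card \<G>) \<le> K"
    using le mid(1) card_incomparable[OF assms(1,2)] unfolding K_def by linarith
  have "int (1 + card \<G>) = K \<longleftrightarrow> card \<G> = card (incomparable A S) \<and>
      2 ^ card S + 2 ^ (card A - card S) = (2::int) ^ ((card A + 1) div 2) + 2 ^ (card A div 2)"
    using le mid(1) card_incomparable[OF assms(1,2)] unfolding K_def by linarith
  then show "int (1 + card \<G>) = K \<longleftrightarrow>
      (card S = card A div 2 \<or> card S = (card A + 1) div 2) \<and> \<G> = incomparable A S"
    using mid(2) eq by auto
qed

text \<open>Two or more sets in \<open>\<F>\<close> give a strict inequality, so equality can only
  arise from a singleton.\<close>

lemma cross_Sperner_small_closure_bound: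
  assumes "finite A" "4 \<le> card A" "\<F> \<subseteq> Pow A" "\<G> \<subseteq> Pow A" "\<F> \<noteq> {}" "cross_Sperner \<F> \<G>"
    and "card (up_closure A \<F>) + card (down_closure \<F>) \<le> 2 ^ card A"
  defines "K \<equiv> 2 ^ card A - 2 ^ ((card A + 1) div 2) - 2 ^ (card A div 2) + 2"
  shows "int (card \<F> + card \<G>) \<le> K \<and> (int (card \<F> + card \<G>) = K \<longrightarrow>
    (\<exists>S\<subseteq>A. (card S = card A div 2 \<or> card S = (card A + 1) div 2) \<and> \<F> = {S} \<and> \<G> = incomparable A S))"
proof (cases "card \<F> = 1")
  case True
  then obtain S where S: "\<F> = {S}" by (rule card_1_singletonE)
  then have "S \<subseteq> A" "cross_Sperner {S} \<G>" using assms(3,6) by auto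
  note * = cross_Sperner_singleton_bound[OF assms(1) this(1) assms(4) this(2), folded K_def]
  show ?thesis using * \<open>S \<subseteq> A\<close> by (auto simp: S)
next
  case False
  moreover have "finite \<F>"
    using assms(1,3) by (auto intro: finite_subset)
  then have "card \<F> \<noteq> 0"
    using assms(5) by simp
  ultimately have "2 \<le> card \<F>" by linarith
  then show ?thesis
    using cross_Sperner_two_sets_bound[OF assms(1-4,6) _ assms(7)] by (auto simp: K_def)
qed

section \<open>The general bound, by exchanging the families\<close>

lemma card_up_down_closure_le:
  assumes "finite A" "\<G> \<subseteq> Pow A" "cross_Sperner \<F> \<G>"
  shows "card (up_closure A \<F>) + card (down_closure \<G>) \<le> 2 ^ card A"
proof -
  have sub: "up_closure A \<F> \<subseteq> Pow A" "down_closure \<G> \<subseteq> Pow A"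
    using assms(2) by (auto simp: up_closure_def down_closure_def)
  \<comment> \<open>A common element would lie above a member of \<open>\<F>\<close> and below a
    member of \<open>\<G>\<close>, making these comparable.\<close>
  have "up_closure A \<F> \<inter> down_closure \<G> = {}"
    using assms(3) by (fastforce simp: up_closure_def down_closure_def cross_Sperner_def)
  then have "card (up_closure A \<F>) + card (down_closure \<G>) = card (up_closure A \<F> \<union> down_closure \<G>)"
    using sub assms(1) by (metis card_Un_disjoint finite_Pow_iff finite_subset)
  also have "\<dots> \<le> card (Pow A)"
    using sub assms(1) by (intro card_mono) auto
  finally show ?thesis using assms(1) by (simp add: card_Pow)
qed

lemma cross_Sperner_bound:
  assumes "finite A" "4 \<le> card A" "\<F> \<subseteq> Pow A" "\<G> \<subseteq> Pow A" "\<F> \<noteq> {}" "\<G> \<noteq> {}" "cross_Sperner \<F> \<G>"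
  defines "K \<equiv> 2 ^ card A - 2 ^ ((card A + 1) div 2) - 2 ^ (card A div 2) + 2"
  shows "int (card \<F> + card \<G>) \<le> K"
    and "int (card \<F> + card \<G>) = K \<longleftrightarrow>
      (\<exists>S\<subseteq>A. (card S = card A div 2 \<or> card S = (card A + 1) div 2) \<and>
        (\<F> = {S} \<and> \<G> = incomparable A S \<or> \<G> = {S} \<and> \<F> = incomparable A S))"
proof -
  let ?mid = "\<lambda>S. card S = card A div 2 \<or> card S = (card A + 1) div 2"
  let ?ext = "\<lambda>\<F> \<G>. \<exists>S\<subseteq>A. ?mid S \<and> \<F> = {S} \<and> \<G> = incomparable A S"
  have cross': "cross_Sperner \<G> \<F>"
    using assms(7) cross_Sperner_sym by blast
  \<comment> \<open>The four closures together have at most \<open>2 * 2 ^ card A\<close> elements,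
    so one family has its own two closures within half of that.\<close>
  consider "card (up_closure A \<F>) + card (down_closure \<F>) \<le> 2 ^ card A"
    | "card (up_closure A \<G>) + card (down_closure \<G>) \<le> 2 ^ card A"
    using card_up_down_closure_le[OF assms(1,4,7)] card_up_down_closure_le[OF assms(1,3) cross']
    by linarith
  then have main: "int (card \<F> + card \<G>) \<le> K \<and> (int (card \<F> + card \<G>) = K \<longrightarrow> ?ext \<F> \<G> \<or> ?ext \<G> \<F>)"
  proof cases
    case 1
    show ?thesis
      using cross_Sperner_small_closure_bound[OF assms(1-5,7) 1] unfolding K_def by blast
  next
    case 2
    show ?thesis
      using cross_Sperner_small_closure_bound[OF assms(1,2,4,3,6) cross' 2]
      unfolding K_def add.commute[of "card \<F>"] by blast
  qed
  \<comment> \<open>The converse of the equality case, kept generic in order to serve both orders of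
    the pair.\<close>
  have ext: "int (card \<F>' + card \<G>') = K"
    if "?ext \<F>' \<G>'" "\<G>' \<subseteq> Pow A" "cross_Sperner \<F>' \<G>'" for \<F>' \<G>'
  proof -
    obtain S where S: "S \<subseteq> A" "?mid S" "\<F>' = {S}" "\<G>' = incomparable A S"
      using \<open>?ext \<F>' \<G>'\<close> by blast
    then show ?thesis
      using cross_Sperner_singleton_bound(2)[OF assms(1) S(1) that(2)] that(3) by (simp add: K_def)
  qed
  show "int (card \<F> + card \<G>) \<le> K" using main by blast
  have "int (card \<F> + card \<G>) = K \<longleftrightarrow> ?ext \<F> \<G> \<or> ?ext \<G> \<F>"
    using main ext[of \<F> \<G>] ext[of \<G> \<F>] assms(3,4,7) cross' by (auto simp only: add.commute)
  then show "int (card \<F> + card \<G>) = K \<longleftrightarrow>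
      (\<exists>S\<subseteq>A. ?mid S \<and> (\<F> = {S} \<and> \<G> = incomparable A S \<or> \<G> = {S} \<and> \<F> = incomparable A S))"
    by blast
qed

section \<open>The value of \<open>F(n,1)\<close> and the conclusion\<close>

lemma max_cross_Sperner_1:
  "int (max_cross_Sperner n 1 + 1) = 2 ^ n - 2 ^ ((n + 1) div 2) - 2 ^ (n div 2) + 2"
proof -
  let ?P = "\<lambda>\<G>. \<G> \<subseteq> Pow {1..n} \<and> (\<exists>\<F>. \<F> \<subseteq> Pow {1..n} \<and> card \<F> = 1 \<and> cross_Sperner \<F> \<G>)"
  \<comment> \<open>A concrete set of size \<open>n div 2\<close>; its incomparable family attains
    the maximum.\<close>
  let ?S = "{1..n div 2}"
  let ?G = "incomparable {1..n} ?S"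
  have S: "?S \<subseteq> {1..n}" by auto
  have G: "?G \<subseteq> Pow {1..n}" by (auto simp: incomparable_def)
  have cross: "cross_Sperner {?S} ?G"
    using cross_Sperner_singleton[OF G] by blast
  have eq: "int (1 + card ?G) = 2 ^ n - 2 ^ ((n + 1) div 2) - 2 ^ (n div 2) + 2"
    using cross_Sperner_singleton_bound(2)[OF _ S G cross] by simp
  have "max_cross_Sperner n 1 = card ?G"
    unfolding max_cross_Sperner_def
  proof (rule Max_eqI)
    have "{card \<G> | \<G>. ?P \<G>} \<subseteq> card ` Pow (Pow {1..n})" by auto
    then show "finite {card \<G> | \<G>. ?P \<G>}" by (rule finite_subset) simp
    show "card ?G \<in> {card \<G> | \<G>. ?P \<G>}"
    proof -
      have "\<exists>\<F>. \<F> \<subseteq> Pow {1..n} \<and> card \<F> = 1 \<and> cross_Sperner \<F> ?G"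
        using S cross by (intro exI[of _ "{?S}"]) simp
      then show ?thesis using G by blast
    qed
    fix y assume "y \<in> {card \<G> | \<G>. ?P \<G>}"
    then obtain \<G> \<F> where y: "y = card \<G>" and H: "\<G> \<subseteq> Pow {1..n}" "\<F> \<subseteq> Pow {1..n}"
      "card \<F> = 1" "cross_Sperner \<F> \<G>" by blast
    obtain T where T: "\<F> = {T}" using H(3) by (rule card_1_singletonE)
    have "T \<subseteq> {1..n}" "cross_Sperner {T} \<G>" using H T by auto
    from cross_Sperner_singleton_bound(1)[OF _ this(1) H(1) this(2)]
    show "y \<le> card ?G" using eq y by simp
  qed
  then show ?thesis using eq by simp
qed

theorem theorem1p1:
  shows "\<exists>n0::nat. \<forall>n\<ge>n0.
    int (max_cross_Sperner n 1 + 1) = 2 ^ n - 2 ^ ((n + 1) div 2) - 2 ^ (n div 2) + 2 \<and>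
    (\<forall>\<F> \<G> :: nat set set.
       \<F> \<subseteq> Pow {1..n} \<and> \<G> \<subseteq> Pow {1..n} \<and> \<F> \<noteq> {} \<and> \<G> \<noteq> {} \<and> cross_Sperner \<F> \<G> \<longrightarrow>
         card \<F> + card \<G> \<le> max_cross_Sperner n 1 + 1 \<and>
         (card \<F> + card \<G> = max_cross_Sperner n 1 + 1 \<longleftrightarrow>
            (\<exists>S \<subseteq> {1..n}. (card S = n div 2 \<or> card S = (n + 1) div 2) \<and>
               (\<F> = {S} \<and> \<G> = {A. A \<subseteq> {1..n} \<and> \<not> A \<subseteq> S \<and> \<not> S \<subseteq> A} \<or>
                \<G> = {S} \<and> \<F> = {A. A \<subseteq> {1..n} \<and> \<not> A \<subseteq> S \<and> \<not> S \<subseteq> A}))))"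
proof (intro exI[of _ 4] allI impI conjI)
  fix n :: nat
  show "int (max_cross_Sperner n 1 + 1) = 2 ^ n - 2 ^ ((n + 1) div 2) - 2 ^ (n div 2) + 2"
    by (rule max_cross_Sperner_1)
  \<comment> \<open>The threshold ensures \<open>2 ^ n \<ge> 16\<close>, as
    \<open>closure_deficiency_ineq\<close> requires.\<close>
  assume n: "4 \<le> n"
  fix \<F> \<G> :: "nat set set"
  assume "\<F> \<subseteq> Pow {1..n} \<and> \<G> \<subseteq> Pow {1..n} \<and> \<F> \<noteq> {} \<and> \<G> \<noteq> {} \<and> cross_Sperner \<F> \<G>"
  then have H: "\<F> \<subseteq> Pow {1..n}" "\<G> \<subseteq> Pow {1..n}" "\<F> \<noteq> {}" "\<G> \<noteq> {}" "cross_Sperner \<F> \<G>"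
    by auto
  \<comment> \<open>Folding replaces the explicit integer formula by
    \<open>max_cross_Sperner n 1 + 1\<close>, so that the comparison can return to the
    naturals.\<close>
  note * = cross_Sperner_bound[OF _ _ H, unfolded card_atLeastAtMost diff_Suc_1, folded max_cross_Sperner_1]
  show "card \<F> + card \<G> \<le> max_cross_Sperner n 1 + 1"
    using *(1) n by simp
  show "card \<F> + card \<G> = max_cross_Sperner n 1 + 1 \<longleftrightarrow>
    (\<exists>S \<subseteq> {1..n}. (card S = n div 2 \<or> card S = (n + 1) div 2) \<and>
       (\<F> = {S} \<and> \<G> = {A. A \<subseteq> {1..n} \<and> \<not> A \<subseteq> S \<and> \<not> S \<subseteq> A} \<or>
        \<G> = {S} \<and> \<F> = {A. A \<subseteq> {1..n} \<and> \<not> A \<subseteq> S \<and> \<not> S \<subseteq> A}))"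
    using *(2) n unfolding incomparable_def of_nat_eq_iff by simp
qed

end
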